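(* Let $n=4k+r$ with integers $k\ge0$ and $0\le r<4$. Then $$t_n(x,y)=2^{k+\lfloor r/2\rfloor}\sum_{i=0}^{k}2^{i}\binom{k}{i}\frac{(1;2)_{k+\lfloor r/2\rfloor}}{(1;2)_{i+\lfloor r/2\rfloor}}\,y^{2k-2i}\,g_{4i+r}(x,y).$$
   Context: For an involution $\pi$ of $[n]$ let $\sigma_1(\pi),\sigma_2(\pi)$ be its numbers of fixed points and 2-cycles, and $t_n(x,y)=\sum_{\pi}x^{\sigma_1(\pi)}y^{\sigma_2(\pi)}$ over all involutions $\pi$ of $[n]$. $(a;b)_m=\prod_{j=0}^{m-1}(a+jb)$. For $m=2u+\rho$ with $\rho\in\{0,1\}$, let $V_m=\{v_1,\dots,v_u\}$ if $\rho=0$ and $\{v_1,\dots,v_{u+1}\}$ if $\rho=1$; $\mathfrak{G}_m$ is the set of loopless multigraphs on $V_m$ with all degrees at most $2$, $v_{u+1}$ (if present) of degree at most $1$, and all edge multiplicities at most $2$ (degrees count multiplicity). The weight ${\rm wt}(G)$ of $G\in\mathfrak{G}_m$ is the product of: $y$ for each edge (counted with multiplicity); for each $v_i$ with $i\le u$, the factor $1$, $x$, or $(x^2+y)/2$ according as $\deg v_i=2,1,0$; and for $v_{u+1}$ (if present), the factor $1$ or $x$ according as $\deg v_{u+1}=1$ or $0$. $g_m(x,y)=\sum_G{\rm wt}(G)$ over all $G\in\mathfrak{G}_m$ having no edge of multiplicity $2$. *)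

theory Defs
  imports "HOL-Library.Multiset" "HOL-Combinatorics.Permutations"
begin

text \<open>
  The polynomials in \<open>x\<close> and \<open>y\<close> have rational coefficients. They are represented by their
  values at arbitrary elements \<open>x\<close>, \<open>y\<close> of an arbitrary field of characteristic 0; taking the
  field of rational functions in two indeterminates recovers the polynomials themselves.
\<close>

definition involutions :: "nat \<Rightarrow> (nat \<Rightarrow> nat) set" where
  "involutions n = {p. p permutes {1..n} \<and> p \<circ> p = id}"

definition fixed_points :: "nat \<Rightarrow> (nat \<Rightarrow> nat) \<Rightarrow> nat" where
  "fixed_points n p = card {i \<in> {1..n}. p i = i}"

text \<open>A 2-cycle \<open>(i j)\<close> of an involution is identified with its support \<open>{i, j}\<close>.\<close>

definition two_cycles :: "nat \<Rightarrow> (nat \<Rightarrow> nat) \<Rightarrow> nat" where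
  "two_cycles n p = card {{i, j} | i j. i \<in> {1..n} \<and> j \<in> {1..n} \<and> i \<noteq> j \<and> p i = j \<and> p j = i}"

definition involution_poly :: "nat \<Rightarrow> 'a::field_char_0 \<Rightarrow> 'a \<Rightarrow> 'a" where
  "involution_poly n x y = (\<Sum>p \<in> involutions n. x ^ fixed_points n p * y ^ two_cycles n p)"

text \<open>The product \<open>(a; b)\<^sub>m = a (a + b) \<dots> (a + (m - 1) b)\<close>.\<close>

definition step_factorial :: "'a::field_char_0 \<Rightarrow> 'a \<Rightarrow> nat \<Rightarrow> 'a" where
  "step_factorial a b m = (\<Prod>j<m. a + of_nat j * b)"

text \<open>
  The vertex \<open>v\<^sub>i\<close> is the number \<open>i\<close>. With \<open>m = 2u + \<rho>\<close>, the ordinary vertices are \<open>1, \<dots>, u\<close>,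
  and \<open>u + 1\<close> is present iff \<open>m\<close> is odd.
\<close>

definition vertex_set :: "nat \<Rightarrow> nat set" where
  "vertex_set m = (if even m then {1..m div 2} else {1..m div 2 + 1})"

text \<open>
  A loopless multigraph is the multiset of its edges, an edge being a 2-element set of vertices.
\<close>

definition vertex_degree :: "nat set multiset \<Rightarrow> nat \<Rightarrow> nat" where
  "vertex_degree G v = size {#e \<in># G. v \<in> e#}"

definition multigraphs :: "nat \<Rightarrow> nat set multiset set" where
  "multigraphs m = {G.
     (\<forall>e \<in># G. e \<subseteq> vertex_set m \<and> card e = 2) \<and>
     (\<forall>v \<in> vertex_set m. vertex_degree G v \<le> 2) \<and>
     (odd m \<longrightarrow> vertex_degree G (m div 2 + 1) \<le> 1) \<and>
     (\<forall>e. count G e \<le> 2)}"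

definition multigraph_weight :: "nat \<Rightarrow> 'a::field_char_0 \<Rightarrow> 'a \<Rightarrow> nat set multiset \<Rightarrow> 'a" where
  "multigraph_weight m x y G =
     y ^ size G *
     (\<Prod>i = 1..m div 2. if vertex_degree G i = 0 then (x\<^sup>2 + y) / 2 else if vertex_degree G i = 1 then x else 1) *
     (if odd m then (if vertex_degree G (m div 2 + 1) = 0 then x else 1) else 1)"

definition multigraph_poly :: "nat \<Rightarrow> 'a::field_char_0 \<Rightarrow> 'a \<Rightarrow> 'a" where
  "multigraph_poly m x y = (\<Sum>G | G \<in> multigraphs m \<and> (\<forall>e. count G e \<noteq> 2). multigraph_weight m x y G)"

text \<open>Both index sets are finite, so neither of the sums is degenerate.\<close>

lemma finite_involutions: "finite (involutions n)"
  by (rule finite_subset[OF _ finite_permutations[of "{1..n}"]]) (auto simp: involutions_def)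

lemma finite_multigraphs: "finite (multigraphs m)"
proof (rule finite_imageD)
  let ?P = "Pow (vertex_set m)"
  have "finite {f. \<forall>e. (e \<in> ?P \<longrightarrow> f e \<in> {..2::nat}) \<and> (e \<notin> ?P \<longrightarrow> f e = 0)}"
    by (rule finite_set_of_finite_funs) (auto simp: vertex_set_def)
  then show "finite (count ` multigraphs m)"
    by (rule rev_finite_subset) (auto simp: multigraphs_def not_in_iff[symmetric])
  show "inj_on count (multigraphs m)"
    by (rule inj_onI) (simp add: multiset_eq_iff)
qed

end

theory Submission imports Defs begin

text \<open>
  Group \<open>2p + q\<close> points into \<open>p\<close> pairs and \<open>q\<close> singletons and contract each pair: an involution
  becomes a multigraph in which pairs have degree at most 2 and singletons degree at most 1.
  Each pair gives a factor 2 (this is why degree 0 has weight \<open>(x\<^sup>2 + y) / 2\<close>), except that each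
  double edge costs a factor 2. So \<open>t\<^bsub>2p+q\<^esub> = 2\<^sup>p U(p, q)\<close>, where
  \<open>U(p, q) = \<Sum>\<^sub>j M(p, j) (y\<^sup>2/2)\<^sup>j s(p - 2j, q)\<close>, \<open>M(p, j)\<close> counts the positions of \<open>j\<close> double
  edges, and \<open>s(p, q)\<close> is the weighted sum over simple graphs. Instead of a contraction bijection,
  the proof removes one vertex at a time: this yields recurrences for \<open>s\<close>, hence for \<open>U\<close>, which
  \<open>2\<^sup>-\<^sup>p t\<^bsub>2p+q\<^esub>\<close> satisfies too, since \<open>t\<^sub>n = s(0, n)\<close> (an involution is a matching).
  The theorem is the case \<open>p = 2k + \<lfloor>r/2\<rfloor>\<close>, \<open>q \<le> 1\<close>, with \<open>M(p, j)\<close> rewritten.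
\<close>

section \<open>Simple graphs and the removal of a single vertex\<close>

definition pairs :: "'v set \<Rightarrow> 'v set set" where
  "pairs A = {e. e \<subseteq> A \<and> card e = 2}"

definition edge_degree :: "'v set set \<Rightarrow> 'v \<Rightarrow> nat" where
  "edge_degree E v = card {e \<in> E. v \<in> e}"

text \<open>The offset \<open>d v\<close> is used for the edges from \<open>v\<close> to vertices already removed, and starts
  at 1 for a vertex of degree at most 1.\<close>

definition graph_sum :: "'a::comm_semiring_1 \<Rightarrow> (nat \<Rightarrow> 'a) \<Rightarrow> 'v set \<Rightarrow> ('v \<Rightarrow> nat) \<Rightarrow> 'a" where
  "graph_sum y f A d =
     (\<Sum>E \<in> Pow (pairs A). y ^ card E * (\<Prod>v\<in>A. f (edge_degree E v + d v)))"

lemma finite_pairs: "finite A \<Longrightarrow> finite (pairs A)"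
  by (rule finite_subset[of _ "Pow A"]) (auto simp: pairs_def)

lemma pairs_insert:
  assumes "v \<notin> A"
  shows "pairs (insert v A) = pairs A \<union> (\<lambda>a. {v, a}) ` A"
proof
  show "pairs (insert v A) \<subseteq> pairs A \<union> (\<lambda>a. {v, a}) ` A"
  proof
    fix e assume e: "e \<in> pairs (insert v A)"
    then obtain a b where ab: "e = {a, b}" "a \<noteq> b"
      by (auto simp: pairs_def card_2_iff)
    with e show "e \<in> pairs A \<union> (\<lambda>a. {v, a}) ` A"
      by (auto simp: pairs_def doubleton_eq_iff)
  qed
  show "pairs A \<union> (\<lambda>a. {v, a}) ` A \<subseteq> pairs (insert v A)"
    using assms by (auto simp: pairs_def card_2_iff)
qed

lemma inj_star: "inj_on (\<lambda>a. {v, a}) A"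
  by (auto simp: inj_on_def doubleton_eq_iff)

lemma card_add_star:
  assumes "finite A" "v \<notin> A" "E \<subseteq> pairs A" "N \<subseteq> A"
  shows "card (E \<union> (\<lambda>a. {v, a}) ` N) = card E + card N"
proof -
  have "E \<inter> (\<lambda>a. {v, a}) ` N = {}"
    using assms by (auto simp: pairs_def)
  moreover have "finite E" "finite N"
    using assms finite_subset finite_pairs by metis+
  ultimately show ?thesis
    by (simp add: card_Un_disjoint card_image[OF inj_star])
qed

lemma edge_degree_add_star_center:
  assumes "v \<notin> A" "E \<subseteq> pairs A"
  shows "edge_degree (E \<union> (\<lambda>a. {v, a}) ` N) v = card N"
proof -
  have "{e \<in> E \<union> (\<lambda>a. {v, a}) ` N. v \<in> e} = (\<lambda>a. {v, a}) ` N"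
    using assms by (auto simp: pairs_def)
  then show ?thesis
    by (simp add: edge_degree_def card_image[OF inj_star])
qed

lemma edge_degree_add_star_leaf:
  assumes "finite A" "v \<notin> A" "E \<subseteq> pairs A" "i \<in> A"
  shows "edge_degree (E \<union> (\<lambda>a. {v, a}) ` N) i = edge_degree E i + of_bool (i \<in> N)"
proof -
  have fin: "finite E"
    using assms finite_subset finite_pairs by metis
  have *: "{e \<in> E \<union> (\<lambda>a. {v, a}) ` N. i \<in> e} =
      {e \<in> E. i \<in> e} \<union> (if i \<in> N then {{v, i}} else {})"
    using assms by (auto simp: pairs_def)
  have "{v, i} \<notin> E"
    using assms by (auto simp: pairs_def)
  with * fin show ?thesis
    by (simp add: edge_degree_def)
qed

text \<open>An edge set splits uniquely into the star from \<open>v\<close> to its neighbourhood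
  \<open>N\<close> and a graph on \<open>A\<close>; each leaf of the star records its lost edge in
  the offset.\<close>

lemma graph_sum_insert:
  assumes "finite A" "v \<notin> A"
  shows "graph_sum y f (insert v A) d =
    (\<Sum>N \<in> Pow A. f (card N + d v) * y ^ card N *
       graph_sum y f A (\<lambda>i. d i + of_bool (i \<in> N)))"
proof -
  let ?s = "\<lambda>a. {v, a}"
  let ?h = "\<lambda>(N, E). E \<union> ?s ` N"
  have bij: "bij_betw ?h (Pow A \<times> Pow (pairs A)) (Pow (pairs (insert v A)))"
  proof (rule bij_betw_byWitness[where f' = "\<lambda>E. ({a \<in> A. ?s a \<in> E}, E \<inter> pairs A)"])
    show "\<forall>p \<in> Pow A \<times> Pow (pairs A).
        (\<lambda>E. ({a \<in> A. ?s a \<in> E}, E \<inter> pairs A)) (?h p) = p"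
      using assms by (auto simp: pairs_def doubleton_eq_iff)
    show "\<forall>E \<in> Pow (pairs (insert v A)). ?h ({a \<in> A. ?s a \<in> E}, E \<inter> pairs A) = E"
      unfolding pairs_insert[OF assms(2)] by auto
  qed (auto simp: pairs_insert[OF assms(2)])
  have "graph_sum y f (insert v A) d =
      (\<Sum>p \<in> Pow A \<times> Pow (pairs A).
         y ^ card (?h p) * (\<Prod>i\<in>insert v A. f (edge_degree (?h p) i + d i)))"
    unfolding graph_sum_def by (rule sum.reindex_bij_betw[OF bij, symmetric])
  also have "\<dots> = (\<Sum>(N, E) \<in> Pow A \<times> Pow (pairs A). f (card N + d v) * y ^ card N *
      (y ^ card E * (\<Prod>i\<in>A. f (edge_degree E i + (d i + of_bool (i \<in> N))))))"
  proof (rule sum.cong[OF refl], clarify)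
    fix N E assume "N \<subseteq> A" "E \<subseteq> pairs A"
    then show "y ^ card (E \<union> ?s ` N) * (\<Prod>i\<in>insert v A. f (edge_degree (E \<union> ?s ` N) i + d i)) =
        f (card N + d v) * y ^ card N *
        (y ^ card E * (\<Prod>i\<in>A. f (edge_degree E i + (d i + of_bool (i \<in> N)))))"
      using assms
      by (simp add: card_add_star edge_degree_add_star_center edge_degree_add_star_leaf
          power_add ac_simps)
  qed
  also have "\<dots> = (\<Sum>N \<in> Pow A. f (card N + d v) * y ^ card N *
       graph_sum y f A (\<lambda>i. d i + of_bool (i \<in> N)))"
    by (simp add: sum.cartesian_product[symmetric] sum_distrib_left graph_sum_def)
  finally show ?thesis .
qed

section \<open>Simple graphs with bounded degrees\<close>

text \<open>The value 0 above degree 2 enforces the degree bound, so sums may range over all edge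
  sets. Started at offset 1, the same function gives the weights \<open>x\<close> and 1 of a vertex
  of degree at most 1.\<close>

definition vertex_weight :: "'a::field_char_0 \<Rightarrow> 'a \<Rightarrow> nat \<Rightarrow> 'a" where
  "vertex_weight x y d =
     (if d = 0 then (x\<^sup>2 + y) / 2 else if d = 1 then x else if d = 2 then 1 else 0)"

lemma graph_sum_eq_0:
  assumes "finite A" "i \<in> A" "d i > 2"
  shows "graph_sum y (vertex_weight x y) A d = 0"
proof -
  have "(\<Prod>v\<in>A. vertex_weight x y (edge_degree E v + d v)) = 0" for E
    using assms by (intro prod_zero) (auto simp: vertex_weight_def intro!: bexI[of _ i])
  then show ?thesis
    by (simp add: graph_sum_def)
qed

text \<open>The weighted sum over simple graphs on \<open>p\<close> vertices that can still take two edges and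
  \<open>q\<close> vertices that can still take one; the recursion removes a vertex of the second kind
  as long as there is one.\<close>

fun cap_poly :: "'a::field_char_0 \<Rightarrow> 'a \<Rightarrow> nat \<Rightarrow> nat \<Rightarrow> 'a" where
  "cap_poly x y 0 0 = 1"
| "cap_poly x y p (Suc q) = x * cap_poly x y p q +
     y * (of_nat p * (if p = 0 then 0 else cap_poly x y (p - 1) (Suc q)) +
          of_nat q * (if q = 0 then 0 else cap_poly x y p (q - 1)))"
| "cap_poly x y (Suc p) 0 = (x\<^sup>2 + y) / 2 * cap_poly x y p 0 +
     x * y * of_nat p * (if p = 0 then 0 else cap_poly x y (p - 1) 1) +
     y\<^sup>2 * of_nat (p choose 2) * (if p < 2 then 0 else cap_poly x y (p - 2) 2)"

text \<open>Applied with \<open>N\<close> the neighbourhood of a removed vertex, whose weight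
  vanishes beyond two neighbours.\<close>

lemma sum_Pow_card_le_2:
  assumes "finite A" "\<And>N. N \<subseteq> A \<Longrightarrow> card N > 2 \<Longrightarrow> g N = 0"
  shows "(\<Sum>N \<in> Pow A. g N) = g {} + (\<Sum>a\<in>A. g {a}) + (\<Sum>N \<in> pairs A. g N)"
proof -
  have "(\<Sum>N \<in> Pow A. g N) = (\<Sum>N \<in> {{}} \<union> (\<lambda>a. {a}) ` A \<union> pairs A. g N)"
  proof (rule sum.mono_neutral_right)
    show "\<forall>N \<in> Pow A - ({{}} \<union> (\<lambda>a. {a}) ` A \<union> pairs A). g N = 0"
    proof
      fix N assume N: "N \<in> Pow A - ({{}} \<union> (\<lambda>a. {a}) ` A \<union> pairs A)"
      then have "finite N"
        using assms(1) finite_subset by auto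
      moreover have "card N \<noteq> 1"
      proof
        assume "card N = 1"
        then obtain a where "N = {a}"
          by (rule card_1_singletonE)
        with N show False
          by auto
      qed
      moreover have "card N \<noteq> 0" "card N \<noteq> 2"
        using N \<open>finite N\<close> by (auto simp: pairs_def)
      ultimately have "card N > 2"
        by linarith
      then show "g N = 0"
        using N assms(2) by blast
    qed
  qed (use assms(1) in \<open>auto simp: pairs_def\<close>)
  also have "\<dots> = (\<Sum>N \<in> {{}} \<union> (\<lambda>a. {a}) ` A. g N) + (\<Sum>N \<in> pairs A. g N)"
    using assms(1) by (intro sum.union_disjoint) (auto simp: finite_pairs, auto simp: pairs_def)
  also have "(\<Sum>N \<in> {{}} \<union> (\<lambda>a. {a}) ` A. g N) = g {} + (\<Sum>a\<in>A. g {a})"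
    using assms(1) by (subst sum.union_disjoint) (auto simp: sum.reindex inj_on_def)
  finally show ?thesis .
qed

text \<open>Removing a vertex only shifts the offsets of its neighbours, so by induction nothing but
  the numbers of offsets 0 and 1 matters; a vertex at offset 2 takes no edge and has weight
  1.\<close>

lemma graph_sum_eq_cap_poly:
  fixes A :: "'v set"
  assumes "finite A" "\<forall>i\<in>A. d i \<le> 2"
  shows "graph_sum y (vertex_weight x y) A d =
    cap_poly x y (card {i\<in>A. d i = 0}) (card {i\<in>A. d i = 1})"
  using assms
proof (induction "card A" arbitrary: A d)
  case 0
  then have "A = {}"
    by simp
  moreover have "pairs ({} :: 'v set) = {}"
    by (auto simp: pairs_def)
  ultimately show ?case
    by (simp add: graph_sum_def)
next
  case (Suc n)
  let ?f = "vertex_weight x y"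
  \<comment> \<open>The order of removal: full vertices first, a vertex of offset 0 only when all
    offsets are 0. The last case then has \<open>q = 0\<close>, as the last clause of
    \<open>cap_poly\<close> requires.\<close>
  have "\<exists>v\<in>A. d v = 2 \<or> d v = 1 \<and> (\<forall>i\<in>A. d i \<noteq> 2) \<or> (\<forall>i\<in>A. d i = 0)"
  proof (rule ccontr)
    assume neg: "\<not> ?thesis"
    then have "\<forall>i\<in>A. d i \<noteq> 2 \<and> d i \<noteq> 1"
      by blast
    then have "\<forall>i\<in>A. d i = 0"
      using Suc.prems(2) by force
    moreover have "A \<noteq> {}"
      using Suc.hyps(2) by auto
    ultimately show False
      using neg by blast
  qed
  then obtain v where v: "v \<in> A"
    "d v = 2 \<or> d v = 1 \<and> (\<forall>i\<in>A. d i \<noteq> 2) \<or> (\<forall>i\<in>A. d i = 0)"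
    by blast
  define B where "B = A - {v}"
  have A: "A = insert v B" and vB: "v \<notin> B" and finB: "finite B" and cB: "n = card B"
    using v(1) Suc.prems(1) Suc.hyps(2) by (auto simp: B_def)
  define p where "p = card {i\<in>B. d i = 0}"
  define q where "q = card {i\<in>B. d i = 1}"
  have IH: "graph_sum y ?f B d' = cap_poly x y (card {i\<in>B. d' i = 0}) (card {i\<in>B. d' i = 1})"
    if "\<forall>i\<in>B. d' i \<le> 2" for d'
    using Suc.hyps(1)[OF cB finB that] .
  have dB: "\<forall>i\<in>B. d i \<le> 2"
    using Suc.prems(2) A by auto
  have *: "graph_sum y ?f A d = ?f (d v) * graph_sum y ?f B d +
      (\<Sum>a\<in>B. ?f (1 + d v) * y * graph_sum y ?f B (\<lambda>i. d i + of_bool (i = a))) +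
      (\<Sum>N \<in> pairs B. ?f (2 + d v) * y\<^sup>2 * graph_sum y ?f B (\<lambda>i. d i + of_bool (i \<in> N)))"
    unfolding A graph_sum_insert[OF finB vB]
    by (subst sum_Pow_card_le_2[OF finB]) (auto simp: vertex_weight_def pairs_def)
  have S0: "graph_sum y ?f B d = cap_poly x y p q"
    using IH[OF dB] by (simp add: p_def q_def)
  \<comment> \<open>A leaf at offset 0 moves to the second count, one at offset 1 becomes full and
    leaves both counts, one at offset 2 makes the sum 0.\<close>
  have S1: "graph_sum y ?f B (\<lambda>i. d i + of_bool (i = a)) =
      (if d a = 0 then cap_poly x y (p - 1) (Suc q) else 0) +
      (if d a = 1 then cap_poly x y p (q - 1) else 0)" if a: "a \<in> B" for a
  proof -
    consider "d a = 0" | "d a = 1" | "d a = 2"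
      using dB a by force
    then show ?thesis
    proof cases
      case 1
      have "{i\<in>B. d i + of_bool (i = a) = 0} = {i\<in>B. d i = 0} - {a}"
        "{i\<in>B. d i + of_bool (i = a) = 1} = insert a {i\<in>B. d i = 1}"
        using 1 a by (auto simp: of_bool_def split: if_splits)
      then show ?thesis
        using 1 a dB finB by (subst IH) (auto simp: p_def q_def)
    next
      case 2
      have "{i\<in>B. d i + of_bool (i = a) = 0} = {i\<in>B. d i = 0}"
        "{i\<in>B. d i + of_bool (i = a) = 1} = {i\<in>B. d i = 1} - {a}"
        using 2 a by (auto simp: of_bool_def split: if_splits)
      then show ?thesis
        using 2 a dB finB by (subst IH) (auto simp: p_def q_def)
    next
      case 3
      then show ?thesis
        using a finB by (simp add: graph_sum_eq_0[of B a])
    qed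
  qed
  have S1_sum: "(\<Sum>a\<in>B. graph_sum y ?f B (\<lambda>i. d i + of_bool (i = a))) =
      of_nat p * cap_poly x y (p - 1) (Suc q) + of_nat q * cap_poly x y p (q - 1)"
    by (simp add: S1 sum.distrib sum.inter_filter[OF finB, symmetric] p_def q_def)
  consider "d v = 2" | "d v = 1" "\<forall>i\<in>A. d i \<noteq> 2" | "\<forall>i\<in>A. d i = 0"
    using v(2) by blast
  then show ?case
  proof cases
    case 1
    have "{i\<in>A. d i = 0} = {i\<in>B. d i = 0}" "{i\<in>A. d i = 1} = {i\<in>B. d i = 1}"
      using 1 A by auto
    then show ?thesis
      using 1 by (simp add: * S0 vertex_weight_def p_def q_def)
  next
    case 2
    have "{i\<in>A. d i = 0} = {i\<in>B. d i = 0}" "{i\<in>A. d i = 1} = insert v {i\<in>B. d i = 1}"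
      using 2 A by auto
    then have "card {i\<in>A. d i = 0} = p" "card {i\<in>A. d i = 1} = Suc q"
      using vB finB by (auto simp: p_def q_def)
    then show ?thesis
      using 2 by (simp add: * S0 S1_sum vertex_weight_def sum_distrib_left[symmetric])
  next
    case 3
    have [simp]: "d i = 0" if "i \<in> A" for i
      using 3 that by blast
    have [simp]: "d i = 0" if "i \<in> B" for i
      using that A by simp
    have pq: "p = card B" "q = 0"
      by (auto simp: p_def q_def cong: conj_cong)
    have cA: "card {i\<in>A. d i = 0} = Suc p" "card {i\<in>A. d i = 1} = 0"
      using Suc.hyps(2) by (auto simp: cB pq cong: conj_cong)
    have S2: "graph_sum y ?f B (\<lambda>i. d i + of_bool (i \<in> N)) = cap_poly x y (p - 2) 2"
      if "N \<in> pairs B" for N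
    proof -
      have N: "N \<subseteq> B" "card N = 2" "finite N"
        using that finB finite_subset by (auto simp: pairs_def)
      have "{i\<in>B. d i + of_bool (i \<in> N) = 0} = B - N" "{i\<in>B. d i + of_bool (i \<in> N) = 1} = N"
        using N by auto
      then show ?thesis
        using N by (subst IH) (auto simp: pq card_Diff_subset)
    qed
    have cp: "card (pairs B) = p choose 2"
      using n_subsets[OF finB, of 2] by (simp add: pairs_def pq)
    show ?thesis
      unfolding cA using v(1)
      by (simp add: * S0 S1_sum S2 cp vertex_weight_def sum_distrib_left[symmetric] pq(2)
          algebra_simps)
  qed
qed

text \<open>At \<open>p = 0\<close> or \<open>q = 0\<close> the truncated subtraction is harmless,
  because its coefficient vanishes.\<close>

lemma cap_poly_Suc_right:
  "cap_poly x y p (Suc q) = x * cap_poly x y p q +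
     y * (of_nat p * cap_poly x y (p - 1) (Suc q) + of_nat q * cap_poly x y p (q - 1))"
  by simp

lemma cap_poly_Suc_0:
  "cap_poly x y (Suc p) 0 = (x\<^sup>2 + y) / 2 * cap_poly x y p 0 +
     x * y * (of_nat p * cap_poly x y (p - 1) 1) +
     y\<^sup>2 * (of_nat (p choose 2) * cap_poly x y (p - 2) 2)"
  by (simp add: binomial_eq_0)

declare cap_poly.simps(2,3) [simp del]

section \<open>Counting the positions of double edges\<close>

lemma step_factorial_0 [simp]: "step_factorial a b 0 = 1"
  by (simp add: step_factorial_def)

lemma step_factorial_Suc: "step_factorial a b (Suc m) = step_factorial a b m * (a + of_nat m * b)"
  by (simp add: step_factorial_def)

text \<open>The number of sets of \<open>j\<close> disjoint edges on \<open>p\<close> vertices, that is, of the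
  possible positions of \<open>j\<close> double edges.\<close>

definition pairing_number :: "nat \<Rightarrow> nat \<Rightarrow> 'a::field_char_0" where
  "pairing_number p j = of_nat (p choose (2 * j)) * step_factorial 1 2 j"

text \<open>Double counting of \<open>j\<close> disjoint edges with one marked uncovered vertex: the
  vertex is marked after the edges are chosen, or before.\<close>

lemma pairing_number_absorb:
  "of_nat (p - 2 * j) * pairing_number p j = of_nat p * pairing_number (p - 1) j"
  unfolding pairing_number_def
  by (metis binomial_absorb_comp mult.assoc of_nat_mult)

text \<open>A distinguished vertex is either uncovered or joined to one of the \<open>p\<close>
  others, which leaves \<open>j\<close> edges on \<open>p - 1\<close> vertices.\<close>

lemma pairing_number_Suc_Suc:
  "pairing_number (Suc p) (Suc j) =
    pairing_number p (Suc j) + of_nat p * pairing_number (p - 1) j"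
proof -
  have "(1 + of_nat j * 2) * of_nat (p choose Suc (2 * j)) =
      (of_nat p * of_nat ((p - 1) choose (2 * j)) :: 'a)"
    using arg_cong[OF binomial_absorption[of "2 * j" p], of "of_nat :: nat \<Rightarrow> 'a"]
    by (simp add: algebra_simps)
  then have "step_factorial 1 2 j * ((1 + of_nat j * 2) * of_nat (p choose Suc (2 * j))) =
      step_factorial 1 2 j * (of_nat p * of_nat ((p - 1) choose (2 * j)) :: 'a)"
    by simp
  then show ?thesis
    by (simp add: pairing_number_def step_factorial_Suc algebra_simps)
qed

lemma pairing_number_eq_0: "p < 2 * j \<Longrightarrow> pairing_number p j = 0"
  by (simp add: pairing_number_def)

text \<open>The multigraph counterpart of \<open>cap_poly\<close>, each double edge carrying an extra factor
  \<open>1 / 2\<close>. The subtraction \<open>p - 2 * j\<close> truncates only where \<open>pairing_number p j = 0\<close>.\<close>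

definition double_sum :: "'a::field_char_0 \<Rightarrow> 'a \<Rightarrow> nat \<Rightarrow> nat \<Rightarrow> 'a" where
  "double_sum x y p q =
     (\<Sum>j\<le>p. pairing_number p j * (y\<^sup>2 / 2) ^ j * cap_poly x y (p - 2 * j) q)"

section \<open>Recurrences for the sums over multigraphs\<close>

text \<open>Terms with \<open>j > m\<close> have \<open>p < 2 * j\<close> and vanish. A common
  cut-off lets the sums for \<open>p\<close>, \<open>p - 1\<close> and \<open>p - 2\<close> be
  combined term by term.\<close>

lemma double_sum_extend:
  assumes "p \<le> 2 * m + 1"
  shows "double_sum x y p q =
    (\<Sum>j\<le>m. pairing_number p j * (y\<^sup>2 / 2) ^ j * cap_poly x y (p - 2 * j) q)"
proof -
  let ?g = "\<lambda>j. pairing_number p j * (y\<^sup>2 / 2) ^ j * cap_poly x y (p - 2 * j) q"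
  have "sum ?g {..p} = sum ?g {..max p m}"
    by (rule sum.mono_neutral_left) (auto simp: pairing_number_eq_0)
  also have "\<dots> = sum ?g {..m}"
    using assms by (intro sum.mono_neutral_right) (auto simp: pairing_number_eq_0)
  finally show ?thesis
    by (simp add: double_sum_def)
qed

lemma double_sum_extend':
  assumes "p \<le> m"
  shows "double_sum x y p q =
    (\<Sum>j\<le>m. pairing_number p j * (y\<^sup>2 / 2) ^ j * cap_poly x y (p - 2 * j) q)"
  by (rule double_sum_extend) (use assms in simp)

lemma double_sum_0_0: "double_sum x y 0 0 = 1"
  by (simp add: double_sum_def pairing_number_def)

text \<open>A vertex with room for one edge never meets a double edge, so the recurrence of
  \<open>cap_poly\<close> carries over term by term, absorption turning the factor
  \<open>p - 2 * j\<close> into \<open>p\<close>.\<close>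

lemma double_sum_Suc_right:
  "double_sum x y p (Suc q) = x * double_sum x y p q +
     y * (of_nat p * double_sum x y (p - 1) (Suc q) + of_nat q * double_sum x y p (q - 1))"
proof -
  let ?M = "\<lambda>p j. pairing_number p j * (y\<^sup>2 / 2) ^ j"
  let ?c = "cap_poly x y"
  have absorb: "?M p j * (of_nat (p - 2 * j) * z) = of_nat p * (?M (p - 1) j * z)" for j and z :: 'a
    using arg_cong[OF pairing_number_absorb[of p j, where 'a = 'a], of "\<lambda>w. w * ((y\<^sup>2 / 2) ^ j * z)"]
    by (simp add: ac_simps)
  have "double_sum x y p (Suc q) = (\<Sum>j\<le>p. ?M p j * ?c (p - 2 * j) (Suc q))"
    by (simp add: double_sum_def)
  also have "\<dots> = (\<Sum>j\<le>p. x * (?M p j * ?c (p - 2 * j) q) +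
      (y * (of_nat p * (?M (p - 1) j * ?c (p - 1 - 2 * j) (Suc q))) +
       y * (of_nat q * (?M p j * ?c (p - 2 * j) (q - 1)))))"
  proof (rule sum.cong[OF refl])
    fix j
    have "?M p j * ?c (p - 2 * j) (Suc q) = x * (?M p j * ?c (p - 2 * j) q) +
       (y * (?M p j * (of_nat (p - 2 * j) * ?c (p - 2 * j - 1) (Suc q))) +
       y * (of_nat q * (?M p j * ?c (p - 2 * j) (q - 1))))"
      unfolding cap_poly_Suc_right[of x y "p - 2 * j" q] by (simp only: ring_distribs ac_simps)
    then show "?M p j * ?c (p - 2 * j) (Suc q) = x * (?M p j * ?c (p - 2 * j) q) +
       (y * (of_nat p * (?M (p - 1) j * ?c (p - 1 - 2 * j) (Suc q))) +
       y * (of_nat q * (?M p j * ?c (p - 2 * j) (q - 1))))"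
      unfolding absorb by simp
  qed
  also have "\<dots> = x * double_sum x y p q +
      (y * (of_nat p * double_sum x y (p - 1) (Suc q)) +
       y * (of_nat q * double_sum x y p (q - 1)))"
    by (simp only: sum.distrib sum_distrib_left[symmetric]
        double_sum_extend'[of _ p] le_refl diff_le_self)
  finally show ?thesis
    by (simp add: ring_distribs)
qed

lemma two_times_choose_two: "2 * of_nat (n choose 2) = (of_nat n * of_nat (n - 1) :: 'a::semiring_1)"
  using arg_cong[OF binomial_absorption[of 1 n], of "of_nat :: nat \<Rightarrow> 'a"]
  by (simp add: numeral_2_eq_2 del: binomial_Suc_Suc) (simp add: mult_2)

text \<open>The same double count with two marked uncovered vertices: after doubling, the binomial
  is a product and absorption applies twice.\<close>

lemma pairing_number_absorb_choose_two:
  "of_nat ((p - 2 * j) choose 2) * pairing_number p j =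
    (of_nat (p choose 2) * pairing_number (p - 2) j :: 'a::field_char_0)"
proof -
  have "2 * (of_nat ((p - 2 * j) choose 2) * pairing_number p j) =
      of_nat (p - 2 * j - 1) * (of_nat (p - 2 * j) * pairing_number p j :: 'a)"
    unfolding mult.assoc[symmetric] two_times_choose_two by (simp add: ac_simps)
  also have "\<dots> = of_nat p * (of_nat (p - 1 - 2 * j) * pairing_number (p - 1) j)"
    unfolding pairing_number_absorb[of p j] diff_commute[of p "2 * j" 1]
    by (rule mult.left_commute)
  also have "\<dots> = 2 * (of_nat (p choose 2) * pairing_number (p - 2) j)"
    unfolding pairing_number_absorb mult.assoc[symmetric] two_times_choose_two
    by (simp add: numeral_2_eq_2)
  finally show ?thesis
    by simp
qed

text \<open>The first three terms remove a vertex with no, one or two simple edges. The last one has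
  no counterpart in \<open>cap_poly\<close>: it removes the vertex with a double edge to one of
  \<open>p\<close> partners, of weight \<open>y\<^sup>2 / 2\<close>.\<close>

lemma double_sum_Suc_0:
  "double_sum x y (Suc p) 0 = (x\<^sup>2 + y) / 2 * double_sum x y p 0 +
     x * y * (of_nat p * double_sum x y (p - 1) 1) +
     y\<^sup>2 * (of_nat (p choose 2) * double_sum x y (p - 2) 2) +
     y\<^sup>2 / 2 * (of_nat p * double_sum x y (p - 1) 0)"
proof -
  let ?Y = "y\<^sup>2 / 2"
  let ?M = "\<lambda>p j. pairing_number p j * ?Y ^ j"
  let ?c = "cap_poly x y"
  have absorb: "?M p j * (of_nat (p - 2 * j) * z) = of_nat p * (?M (p - 1) j * z)" for j and z :: 'a
    using arg_cong[OF pairing_number_absorb[of p j, where 'a = 'a], of "\<lambda>w. w * (?Y ^ j * z)"]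
    by (simp add: ac_simps)
  have absorb2: "?M p j * (of_nat ((p - 2 * j) choose 2) * z) =
      of_nat (p choose 2) * (?M (p - 2) j * z)" for j and z :: 'a
    using arg_cong[OF pairing_number_absorb_choose_two[of p j, where 'a = 'a],
        of "\<lambda>w. w * (?Y ^ j * z)"]
    by (simp add: ac_simps)
  have "double_sum x y (Suc p) 0 = (\<Sum>j\<le>Suc p. ?M (Suc p) j * ?c (Suc p - 2 * j) 0)"
    by (simp add: double_sum_def)
  \<comment> \<open>The term \<open>j = 0\<close> is split off because
    \<open>pairing_number_Suc_Suc\<close> concerns positive indices.\<close>
  also have "\<dots> = ?M p 0 * ?c (Suc p) 0 + (\<Sum>j\<le>p. ?M p (Suc j) * ?c (Suc p - 2 * Suc j) 0 +
      ?Y * (of_nat p * (?M (p - 1) j * ?c (p - 1 - 2 * j) 0)))"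
    unfolding sum.atMost_Suc_shift pairing_number_Suc_Suc
    by (simp add: pairing_number_def ring_distribs ac_simps)
  also have "\<dots> = (\<Sum>j\<le>Suc p. ?M p j * ?c (Suc p - 2 * j) 0) +
      ?Y * (of_nat p * double_sum x y (p - 1) 0)"
    by (simp only: sum.atMost_Suc_shift sum.distrib sum_distrib_left[symmetric]
        double_sum_extend'[of _ p] diff_le_self add.assoc mult_0_right diff_zero)
  also have "(\<Sum>j\<le>Suc p. ?M p j * ?c (Suc p - 2 * j) 0) =
      (\<Sum>j\<le>Suc p. (x\<^sup>2 + y) / 2 * (?M p j * ?c (p - 2 * j) 0) +
        x * y * (of_nat p * (?M (p - 1) j * ?c (p - 1 - 2 * j) 1)) +
        y\<^sup>2 * (of_nat (p choose 2) * (?M (p - 2) j * ?c (p - 2 - 2 * j) 2)))"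
  proof (rule sum.cong[OF refl])
    fix j
    \<comment> \<open>The two arguments differ only when \<open>2 * j > p\<close>, where
      \<open>pairing_number p j\<close> is 0.\<close>
    have "?M p j * ?c (Suc p - 2 * j) 0 = ?M p j * ?c (Suc (p - 2 * j)) 0"
      by (cases "2 * j \<le> p") (simp_all add: Suc_diff_le pairing_number_eq_0)
    also have "\<dots> = (x\<^sup>2 + y) / 2 * (?M p j * ?c (p - 2 * j) 0) +
        x * y * (?M p j * (of_nat (p - 2 * j) * ?c (p - 2 * j - 1) 1)) +
        y\<^sup>2 * (?M p j * (of_nat ((p - 2 * j) choose 2) * ?c (p - 2 * j - 2) 2))"
      unfolding cap_poly_Suc_0 by (simp only: ring_distribs ac_simps)
    finally show "?M p j * ?c (Suc p - 2 * j) 0 = (x\<^sup>2 + y) / 2 * (?M p j * ?c (p - 2 * j) 0) +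
        x * y * (of_nat p * (?M (p - 1) j * ?c (p - 1 - 2 * j) 1)) +
        y\<^sup>2 * (of_nat (p choose 2) * (?M (p - 2) j * ?c (p - 2 - 2 * j) 2))"
      unfolding absorb absorb2 by simp
  qed
  also have "\<dots> = (x\<^sup>2 + y) / 2 * double_sum x y p 0 +
     x * y * (of_nat p * double_sum x y (p - 1) 1) +
     y\<^sup>2 * (of_nat (p choose 2) * double_sum x y (p - 2) 2)"
    by (simp only: sum.distrib sum_distrib_left[symmetric] double_sum_extend'[of _ "Suc p"]
        le_SucI le_refl diff_le_self)
  finally show ?thesis .
qed

section \<open>Contraction of \<open>p\<close> pairs of points\<close>

text \<open>Strong induction on the number \<open>2 * p + q\<close> of points. If
  \<open>q > 0\<close>, removing a singleton matches one use of \<open>t_Suc\<close>; if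
  \<open>q = 0\<close>, removing a pair matches iterated uses.\<close>

lemma cap_poly_eq_double_sum: "cap_poly x y 0 (2 * p + q) = 2 ^ p * double_sum x y p q"
proof (induction "2 * p + q" arbitrary: p q rule: less_induct)
  case less
  let ?t = "cap_poly x y 0"
  let ?D = "double_sum x y"
  \<comment> \<open>The classical recurrence for involutions: a new point is fixed or swapped with
    one of \<open>m\<close> others.\<close>
  have t_Suc: "?t (Suc m) = x * ?t m + y * (of_nat m * ?t (m - 1))" for m
    using cap_poly_Suc_right[of x y 0 m] by simp
  consider (Suc) q' where "q = Suc q'" | (0) "p = 0" "q = 0" | (1) "p = 1" "q = 0"
    | (2) r where "p = Suc (Suc r)" "q = 0"
    by (metis One_nat_def not0_implies_Suc)
  then show ?case
  proof cases
    case Suc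
    \<comment> \<open>Lowering \<open>p\<close> frees a factor 2, so \<open>p\<close> pairs count as
      \<open>2 * p\<close> points; with the \<open>q'\<close> singletons this gives the coefficient
      \<open>2 * p + q'\<close> of \<open>t_Suc\<close>.\<close>
    have a: "of_nat p * (2 ^ p * ?D (p - 1) (Suc q')) = of_nat (2 * p) * ?t (2 * p + q' - 1)"
    proof (cases p)
      case p: (Suc p')
      have "?t (2 * p' + Suc q') = 2 ^ p' * ?D p' (Suc q')"
        using p Suc by (intro less) simp
      then show ?thesis
        using p by simp
    qed simp
    have b: "of_nat q' * (2 ^ p * ?D p (q' - 1)) = of_nat q' * ?t (2 * p + q' - 1)"
    proof (cases q')
      case q: (Suc q'')
      have "?t (2 * p + q'') = 2 ^ p * ?D p q''"
        using q Suc by (intro less) simp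
      then show ?thesis
        using q by simp
    qed simp
    have c: "?t (2 * p + q') = 2 ^ p * ?D p q'"
      using Suc by (intro less) simp
    have "2 ^ p * ?D p q = x * (2 ^ p * ?D p q') +
        y * (of_nat p * (2 ^ p * ?D (p - 1) (Suc q')) + of_nat q' * (2 ^ p * ?D p (q' - 1)))"
      unfolding Suc double_sum_Suc_right[of x y p q'] by (simp only: ring_distribs ac_simps)
    then have "2 ^ p * ?D p q = x * ?t (2 * p + q') +
        y * (of_nat (2 * p) * ?t (2 * p + q' - 1) + of_nat q' * ?t (2 * p + q' - 1))"
      by (simp only: a b c)
    then show ?thesis
      by (simp add: Suc t_Suc ring_distribs)
  next
    case 0
    then show ?thesis
      by (simp add: double_sum_0_0)
  next
    case 1
    then show ?thesis
      using double_sum_Suc_0[of x y 0] t_Suc[of 0] t_Suc[of 1]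
      by (simp add: double_sum_0_0 numeral_2_eq_2 field_simps)
  next
    case 2
    have a: "?t (2 * r + 2) = 2 ^ Suc r * ?D (Suc r) 0"
      using less[of "Suc r" 0] 2 by simp
    have b: "?t (2 * r + 1) = 2 ^ r * ?D r 1"
      using less[of r 1] 2 by simp
    have c: "?t (2 * r) = 2 ^ r * ?D r 0"
      using less[of r 0] 2 by simp
    \<comment> \<open>The hypothesis supplies only \<open>2 ^ (r - 1)\<close>; the spare 2 clears
      the binomial. At \<open>r = 0\<close> both sides are 0.\<close>
    have d: "2 ^ r * (of_nat (Suc r choose 2) * ?D (r - 1) 2) = of_nat (Suc r) * (of_nat r * ?t (2 * r))"
    proof (cases r)
      case r: (Suc r')
      have "?t (2 * r) = 2 ^ r' * ?D r' 2"
        using less[of r' 2] 2 r by simp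
      moreover have "2 ^ r * (of_nat (Suc r choose 2) * ?D (r - 1) 2) =
          (2 * of_nat (Suc r choose 2)) * (2 ^ r' * ?D r' 2)"
        by (simp add: r)
      ultimately show ?thesis
        unfolding two_times_choose_two by simp
    qed (simp add: binomial_eq_0)
    have "2 ^ p * ?D p 0 = (x\<^sup>2 + y) * (2 ^ Suc r * ?D (Suc r) 0) +
        4 * x * y * (of_nat (Suc r) * (2 ^ r * ?D r 1)) +
        4 * y\<^sup>2 * (2 ^ r * (of_nat (Suc r choose 2) * ?D (r - 1) 2)) +
        2 * y\<^sup>2 * (of_nat (Suc r) * (2 ^ r * ?D r 0))"
      unfolding 2 double_sum_Suc_0[of x y "Suc r"] by (simp add: field_simps)
    also have "\<dots> = (x\<^sup>2 + y) * ?t (2 * r + 2) + 4 * x * y * (of_nat (Suc r) * ?t (2 * r + 1)) +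
        4 * y\<^sup>2 * (of_nat (Suc r) * (of_nat r * ?t (2 * r))) + 2 * y\<^sup>2 * (of_nat (Suc r) * ?t (2 * r))"
      by (simp only: a b c d)
    also have "\<dots> = ?t (Suc (Suc (2 * r + 2)))"
    proof -
      \<comment> \<open>Expanding one level further produces the terms in \<open>?t (2 * r)\<close>:
        those from two simple edges and from a double edge add up by
        \<open>4 * (r + 1) * r + 2 * (r + 1) = (2 * r + 2) * (2 * r + 1)\<close>.\<close>
      have e: "?t (2 * r + 2) = x * ?t (2 * r + 1) + y * (of_nat (2 * r + 1) * ?t (2 * r))"
        using t_Suc[of "2 * r + 1"] by simp
      have "?t (Suc (Suc (2 * r + 2))) =
          x * (x * ?t (2 * r + 2) + y * (of_nat (2 * r + 2) * ?t (2 * r + 1))) +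
          y * (of_nat (2 * r + 3) * ?t (2 * r + 2))"
        using t_Suc[of "Suc (2 * r + 2)"] t_Suc[of "2 * r + 2"] by (simp add: numeral_eq_Suc)
      also have "\<dots> = (x\<^sup>2 + y) * ?t (2 * r + 2) +
          x * y * (of_nat (2 * r + 2) * ?t (2 * r + 1)) +
          y * (of_nat (2 * r + 2) * ?t (2 * r + 2))"
        by (simp add: algebra_simps power2_eq_square)
      finally show ?thesis
        unfolding e by (simp add: algebra_simps power2_eq_square)
    qed
    finally show ?thesis
      using 2 by (simp add: numeral_eq_Suc)
  qed
qed

section \<open>Multigraph and involution polynomials as graph sums\<close>

lemma graph_sum_restrict:
  assumes "finite A"
  shows "graph_sum y (vertex_weight x y) A d =
    (\<Sum>E | E \<subseteq> pairs A \<and> (\<forall>v\<in>A. edge_degree E v + d v \<le> 2).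
       y ^ card E * (\<Prod>v\<in>A. vertex_weight x y (edge_degree E v + d v)))"
  unfolding graph_sum_def
proof (rule sum.mono_neutral_right)
  show "\<forall>E \<in> Pow (pairs A) - {E. E \<subseteq> pairs A \<and> (\<forall>v\<in>A. edge_degree E v + d v \<le> 2)}.
      y ^ card E * (\<Prod>v\<in>A. vertex_weight x y (edge_degree E v + d v)) = 0"
  proof
    fix E assume "E \<in> Pow (pairs A) - {E. E \<subseteq> pairs A \<and> (\<forall>v\<in>A. edge_degree E v + d v \<le> 2)}"
    then obtain v where "v \<in> A" "edge_degree E v + d v > 2"
      by (auto simp: not_le)
    then have "(\<Prod>v\<in>A. vertex_weight x y (edge_degree E v + d v)) = 0"
      using assms by (intro prod_zero) (auto simp: vertex_weight_def intro!: bexI[of _ v])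
    then show "y ^ card E * (\<Prod>v\<in>A. vertex_weight x y (edge_degree E v + d v)) = 0"
      by simp
  qed
qed (use assms in \<open>auto simp: finite_pairs\<close>)

text \<open>With every multiplicity at most 2 and none equal to 2, a multigraph is determined by its
  set of edges.\<close>

lemma multigraph_poly_eq_cap_poly:
  "multigraph_poly m x y = cap_poly x y (m div 2) (m mod 2)"
proof -
  let ?V = "vertex_set m"
  \<comment> \<open>Offset 1 lowers the degree bound of the extra vertex to 1 and shifts its weights
    to \<open>x\<close> and 1; for even \<open>m\<close> this vertex lies outside
    \<open>?V\<close>.\<close>
  define d where "d = (\<lambda>i. of_bool (i = m div 2 + 1) :: nat)"
  have finV: "finite ?V"
    by (simp add: vertex_set_def)
  have finE: "finite E" if "E \<subseteq> pairs ?V" for E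
    using that finV finite_pairs finite_subset by blast
  have deg: "vertex_degree (mset_set E) v = edge_degree E v" if "finite E" for E v
    using that by (simp add: vertex_degree_def edge_degree_def)
  have V_eq: "?V = (if odd m then insert (m div 2 + 1) {1..m div 2} else {1..m div 2})"
    by (auto simp: vertex_set_def)
  have d_odd: "(\<forall>v\<in>?V. g v + d v \<le> 2) \<longleftrightarrow>
      (\<forall>v\<in>?V. g v \<le> 2) \<and> (odd m \<longrightarrow> g (m div 2 + 1) \<le> 1)" for g :: "nat \<Rightarrow> nat"
    by (auto simp: V_eq d_def)
  have "bij_betw mset_set {E. E \<subseteq> pairs ?V \<and> (\<forall>v\<in>?V. edge_degree E v + d v \<le> 2)}
      {G \<in> multigraphs m. \<forall>e. count G e \<noteq> 2}" (is "bij_betw _ ?E ?G")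
  proof (rule bij_betw_byWitness[where f' = set_mset])
    show "\<forall>E\<in>?E. set_mset (mset_set E) = E"
      using finE by auto
    have simple: "mset_set (set_mset G) = G" if "G \<in> ?G" for G
    proof (rule multiset_eqI)
      fix e
      have "count G e \<le> 2" "count G e \<noteq> 2"
        using that by (auto simp: multigraphs_def)
      then have "count G e = 0 \<or> count G e = 1"
        by linarith
      then show "count (mset_set (set_mset G)) e = count G e"
        by (auto simp: count_mset_set' simp flip: count_greater_zero_iff)
    qed
    then show "\<forall>G\<in>?G. mset_set (set_mset G) = G"
      by blast
    show "mset_set ` ?E \<subseteq> ?G"
    proof
      fix G assume "G \<in> mset_set ` ?E"
      then obtain E where E: "G = mset_set E" "E \<in> ?E"
        by blast
      then show "G \<in> ?G"
        using finE[of E] unfolding d_odd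
        by (auto simp: multigraphs_def deg count_mset_set' pairs_def)
    qed
    show "set_mset ` ?G \<subseteq> ?E"
    proof
      fix E assume "E \<in> set_mset ` ?G"
      then obtain G where G: "E = set_mset G" "G \<in> ?G"
        by blast
      then have "edge_degree E v = vertex_degree G v" for v
        using deg[of E v] simple[of G] by simp
      with G show "E \<in> ?E"
        unfolding d_odd by (auto simp: multigraphs_def pairs_def)
    qed
  qed
  then have "multigraph_poly m x y = (\<Sum>E\<in>?E. multigraph_weight m x y (mset_set E))"
    unfolding multigraph_poly_def by (rule sum.reindex_bij_betw[symmetric])
  also have "\<dots> = graph_sum y (vertex_weight x y) ?V d"
    unfolding graph_sum_restrict[OF finV]
  proof (rule sum.cong[OF refl])
    fix E assume E: "E \<in> ?E"
    then have deg_E: "vertex_degree (mset_set E) v = edge_degree E v" for v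
      using finE deg by blast
    have "(\<Prod>v\<in>{1..m div 2}. vertex_weight x y (edge_degree E v + d v)) =
       (\<Prod>i = 1..m div 2. if vertex_degree (mset_set E) i = 0 then (x\<^sup>2 + y) / 2
          else if vertex_degree (mset_set E) i = 1 then x else 1)"
    proof (rule prod.cong[OF refl])
      fix i assume i: "i \<in> {1..m div 2}"
      then have "edge_degree E i + d i \<le> 2"
        using E by (auto simp: vertex_set_def)
      with i show "vertex_weight x y (edge_degree E i + d i) =
          (if vertex_degree (mset_set E) i = 0 then (x\<^sup>2 + y) / 2
           else if vertex_degree (mset_set E) i = 1 then x else 1)"
        by (auto simp: d_def deg_E vertex_weight_def)
    qed
    moreover have "vertex_weight x y (edge_degree E (m div 2 + 1) + d (m div 2 + 1)) =
        (if vertex_degree (mset_set E) (m div 2 + 1) = 0 then x else 1)" if "odd m"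
    proof -
      have "edge_degree E (m div 2 + 1) + d (m div 2 + 1) \<le> 2"
        using E that by (auto simp: vertex_set_def)
      then show ?thesis
        by (auto simp: d_def deg_E vertex_weight_def)
    qed
    ultimately show "multigraph_weight m x y (mset_set E) =
        y ^ card E * (\<Prod>v\<in>?V. vertex_weight x y (edge_degree E v + d v))"
      by (simp add: multigraph_weight_def V_eq ac_simps)
  qed
  also have "\<dots> = cap_poly x y (card {i\<in>?V. d i = 0}) (card {i\<in>?V. d i = 1})"
    using finV by (intro graph_sum_eq_cap_poly) (auto simp: d_def)
  also have "{i\<in>?V. d i = 0} = {1..m div 2}"
    by (auto simp: vertex_set_def d_def)
  also have "{i\<in>?V. d i = 1} = (if odd m then {m div 2 + 1} else {})"
    by (auto simp: vertex_set_def d_def)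
  finally show ?thesis
    by (simp add: odd_iff_mod_2_eq_one even_iff_mod_2_eq_zero split: if_splits)
qed

text \<open>The 2-cycles form a matching, a graph of degrees at most 1, so every offset is 1; the
  uncovered vertices, of weight \<open>x\<close>, are the fixed points.\<close>

lemma involution_poly_eq_cap_poly:
  "involution_poly n x y = cap_poly x y 0 n"
proof -
  let ?A = "{1..n}"
  let ?C = "\<lambda>p. {{i, p i} | i. i \<in> ?A \<and> p i \<noteq> i}"
  let ?M = "{E. E \<subseteq> pairs ?A \<and> (\<forall>v\<in>?A. edge_degree E v + 1 \<le> 2)}"
  have inv: "p (p i) = i" "p i \<in> ?A \<longleftrightarrow> i \<in> ?A" "i \<notin> ?A \<Longrightarrow> p i = i"
    if "p \<in> involutions n" for p i
  proof -
    have p: "p permutes ?A" "p \<circ> p = id"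
      using that by (auto simp: involutions_def)
    show "p (p i) = i"
      using fun_cong[OF p(2), of i] by simp
    show "p i \<in> ?A \<longleftrightarrow> i \<in> ?A"
      using permutes_in_image[OF p(1)] .
    show "i \<notin> ?A \<Longrightarrow> p i = i"
      using p(1) by (simp add: permutes_not_in)
  qed
  have edge_iff: "{i, j} \<in> ?C p \<longleftrightarrow> i \<in> ?A \<and> p i = j \<and> i \<noteq> j"
    if "p \<in> involutions n" for p i j
    using inv[OF that] by (auto simp: doubleton_eq_iff)
  have star: "{e \<in> ?C p. v \<in> e} = (if p v = v then {} else {{v, p v}})"
    if "p \<in> involutions n" "v \<in> ?A" for p v
    using inv[OF that(1)] that(2) by auto
  have deg: "edge_degree (?C p) v = (if p v = v then 0 else 1)"
    if "p \<in> involutions n" "v \<in> ?A" for p v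
    unfolding edge_degree_def star[OF that] by simp
  have bij: "bij_betw ?C (involutions n) ?M"
    unfolding bij_betw_def
  proof
    show "inj_on ?C (involutions n)"
    proof (rule inj_onI, rule ext)
      fix p q i assume p: "p \<in> involutions n" and q: "q \<in> involutions n" and eq: "?C p = ?C q"
      have "i \<in> ?A \<and> p i = j \<and> i \<noteq> j \<longleftrightarrow> i \<in> ?A \<and> q i = j \<and> i \<noteq> j" for j
        unfolding edge_iff[OF p, symmetric] edge_iff[OF q, symmetric] eq ..
      then show "p i = q i"
        using inv(3)[OF p] inv(3)[OF q] by metis
    qed
    show "?C ` involutions n = ?M"
    proof
      show "?C ` involutions n \<subseteq> ?M"
      proof
        fix E assume "E \<in> ?C ` involutions n"
        then obtain p where p: "p \<in> involutions n" "E = ?C p"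
          by blast
        have "{i, p i} \<in> pairs ?A" if "i \<in> ?A" "p i \<noteq> i" for i
          using that inv(2)[OF p(1), of i] by (simp add: pairs_def)
        then have "?C p \<subseteq> pairs ?A"
          by blast
        moreover have "\<forall>v\<in>?A. edge_degree (?C p) v + 1 \<le> 2"
          using deg[OF p(1)] by simp
        ultimately show "E \<in> ?M"
          unfolding p(2) by blast
      qed
      show "?M \<subseteq> ?C ` involutions n"
      proof
        fix E assume E: "E \<in> ?M"
        have finE: "finite E"
          using E finite_pairs[of ?A] finite_subset by blast
        have in_A: "v \<in> ?A \<and> w \<in> ?A \<and> v \<noteq> w" if "{v, w} \<in> E" for v w
          using E that by (auto simp: pairs_def card_2_iff doubleton_eq_iff)
        have uniq: "w = w'" if "{v, w} \<in> E" "{v, w'} \<in> E" for v w w'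
        proof -
          have "card {e \<in> E. v \<in> e} \<le> 1"
            using E in_A[OF that(1)] by (auto simp: edge_degree_def)
          then have "{v, w} = {v, w'}"
            using that finE by (auto simp: card_le_Suc0_iff_eq)
          then show ?thesis
            by (auto simp: doubleton_eq_iff)
        qed
        \<comment> \<open>The partner of \<open>v\<close> in the matching, unique by
          \<open>uniq\<close>, or \<open>v\<close> itself if it is uncovered.\<close>
        define p where "p v = (if \<exists>w. {v, w} \<in> E then THE w. {v, w} \<in> E else v)" for v
        have p_eq: "p v = w" if "{v, w} \<in> E" for v w
        proof -
          have "(THE w. {v, w} \<in> E) = w"
            using that uniq by (intro the_equality)
          then show ?thesis
            using that by (auto simp: p_def)
        qed
        have p_edge: "{v, p v} \<in> E" if "p v \<noteq> v" for v
        proof -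
          obtain w where "{v, w} \<in> E"
            using \<open>p v \<noteq> v\<close> by (auto simp: p_def split: if_splits)
          then show ?thesis
            using p_eq by simp
        qed
        have pp: "p (p v) = v" for v
        proof (cases "p v = v")
          case False
          then have "{p v, v} \<in> E"
            using p_edge[of v] by (simp add: insert_commute)
          then show ?thesis
            by (rule p_eq)
        qed simp
        have "p v = v" if "v \<notin> ?A" for v
          using p_edge[of v] in_A that by blast
        then have "p permutes ?A"
          unfolding permutes_def using pp by metis
        then have "p \<in> involutions n"
          using pp by (auto simp: involutions_def)
        moreover have "?C p = E"
        proof
          show "?C p \<subseteq> E"
            using p_edge by auto
          show "E \<subseteq> ?C p"
          proof
            fix e assume e: "e \<in> E"
            then obtain v w where vw: "e = {v, w}"
              using E by (auto simp: pairs_def card_2_iff)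
            then show "e \<in> ?C p"
              using e in_A[of v w] p_eq[of v w] by auto
          qed
        qed
        ultimately show "E \<in> ?C ` involutions n"
          by blast
      qed
    qed
  qed
  have "involution_poly n x y =
      (\<Sum>p\<in>involutions n. y ^ card (?C p) * (\<Prod>v\<in>?A. vertex_weight x y (edge_degree (?C p) v + 1)))"
    unfolding involution_poly_def
  proof (rule sum.cong[OF refl])
    fix p assume p: "p \<in> involutions n"
    have "{{i, j} | i j. i \<in> ?A \<and> j \<in> ?A \<and> i \<noteq> j \<and> p i = j \<and> p j = i} = ?C p"
      using inv[OF p] by fastforce
    then have "two_cycles n p = card (?C p)"
      by (simp add: two_cycles_def)
    moreover have "(\<Prod>v\<in>?A. vertex_weight x y (edge_degree (?C p) v + 1)) =
        (\<Prod>v\<in>?A. if p v = v then x else 1)"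
    proof (rule prod.cong[OF refl])
      fix v assume "v \<in> ?A"
      from deg[OF p this] show "vertex_weight x y (edge_degree (?C p) v + 1) = (if p v = v then x else 1)"
        by (simp only: vertex_weight_def) simp
    qed
    ultimately show "x ^ fixed_points n p * y ^ two_cycles n p =
        y ^ card (?C p) * (\<Prod>v\<in>?A. vertex_weight x y (edge_degree (?C p) v + 1))"
      by (simp add: fixed_points_def prod.inter_filter[symmetric])
  qed
  also have "\<dots> = graph_sum y (vertex_weight x y) ?A (\<lambda>_. 1)"
    unfolding graph_sum_restrict[OF finite_atLeastAtMost]
    by (rule sum.reindex_bij_betw[OF bij])
  also have "\<dots> = cap_poly x y 0 n"
    by (simp add: graph_sum_eq_cap_poly del: atLeastAtMost_iff)
  finally show ?thesis .
qed

section \<open>Closed form of the pairing numbers, and the final formula\<close>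

text \<open>The even factors of the factorial give \<open>2 ^ k * fact k\<close>, the odd ones the
  step factorial.\<close>

lemma fact_eq_step_factorial:
  assumes "s \<le> 1"
  shows "fact (2 * k + s) = (2 ^ k * fact k * step_factorial 1 2 (k + s) :: 'a::field_char_0)"
proof (induction k)
  case 0
  from assms have "s = 0 \<or> s = 1"
    by linarith
  then show ?case
    by (auto simp: step_factorial_def)
next
  case (Suc k)
  from assms have s: "s = 0 \<or> s = 1"
    by linarith
  have "fact (2 * Suc k + s) = of_nat (2 * k + s + 2) * (of_nat (2 * k + s + 1) * (fact (2 * k + s) :: 'a))"
    by (simp add: algebra_simps)
  with Suc s show ?case
    by (auto simp: step_factorial_Suc algebra_simps)
qed

lemma step_factorial_neq_0: "step_factorial 1 2 m \<noteq> (0 :: 'a::field_char_0)"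
proof -
  have "1 + of_nat j * 2 \<noteq> (0 :: 'a)" for j
  proof -
    have "1 + of_nat j * 2 = (of_nat (1 + j * 2) :: 'a)"
      by simp
    then show ?thesis
      by (metis of_nat_eq_0_iff add_is_0 one_neq_zero)
  qed
  then show ?thesis
    by (simp add: step_factorial_def)
qed

text \<open>The \<open>2 * (k - i)\<close> covered vertices leave \<open>2 * i + s\<close> others,
  so each factorial in the binomial splits into even and odd factors, and the odd part for the
  covered vertices cancels.\<close>

lemma pairing_number_eq:
  assumes "i \<le> k" "s \<le> 1"
  shows "pairing_number (2 * k + s) (k - i) =
    (of_nat (k choose i) * (step_factorial 1 2 (k + s) / step_factorial 1 2 (i + s)) :: 'a::field_char_0)"
proof -
  define j where "j = k - i"
  have k: "k = i + j"
    using assms by (simp add: j_def)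
  \<comment> \<open>The \<open>+ 0\<close> presents this factorial as the case \<open>s = 0\<close>
    of \<open>fact_eq_step_factorial\<close>.\<close>
  have "of_nat ((2 * k + s) choose (2 * j)) =
      (fact (2 * k + s) / (fact (2 * j + 0) * fact (2 * i + s)) :: 'a)"
    using binomial_fact[of "2 * j" "2 * k + s", where 'a = 'a] by (simp add: k)
  also have "\<dots> = (2 ^ k * fact k * step_factorial 1 2 (k + s)) /
      ((2 ^ j * fact j * step_factorial 1 2 j) * (2 ^ i * fact i * step_factorial 1 2 (i + s)))"
    unfolding fact_eq_step_factorial[OF assms(2)] fact_eq_step_factorial[OF zero_le_one] by simp
  also have "(2 :: 'a) ^ k = 2 ^ j * 2 ^ i"
    by (simp add: k power_add)
  finally have "pairing_number (2 * k + s) j =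
      (fact k / (fact i * fact j) * (step_factorial 1 2 (k + s) / step_factorial 1 2 (i + s)) :: 'a)"
    using step_factorial_neq_0[of j, where 'a = 'a]
    by (simp add: pairing_number_def)
  moreover have "of_nat (k choose i) = (fact k / (fact i * fact j) :: 'a)"
    using binomial_fact[of i k, where 'a = 'a] by (simp add: k)
  ultimately show ?thesis
    by (simp add: j_def)
qed

theorem theorem4p1:
  fixes x y :: "'a::field_char_0" and n k r :: nat
  assumes "n = 4 * k + r" and "r < 4"
  shows "involution_poly n x y =
    2 ^ (k + r div 2) *
    (\<Sum>i = 0..k. 2 ^ i * of_nat (k choose i) *
       (step_factorial 1 2 (k + r div 2) / step_factorial 1 2 (i + r div 2)) *
       y ^ (2 * k - 2 * i) * multigraph_poly (4 * i + r) x y)"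
proof -
  define s where "s = r div 2"
  have s: "s \<le> 1"
    using assms(2) by (simp add: s_def)
  let ?p = "2 * k + s"
  \<comment> \<open>All points are paired, except one when \<open>n\<close> is odd.\<close>
  have "n = 2 * ?p + r mod 2"
    using assms(1) by (simp add: s_def)
  then have "involution_poly n x y = 2 ^ ?p * double_sum x y ?p (r mod 2)"
    by (simp only: involution_poly_eq_cap_poly cap_poly_eq_double_sum)
  also have "double_sum x y ?p (r mod 2) =
      (\<Sum>j = 0..k. pairing_number ?p j * (y\<^sup>2 / 2) ^ j * cap_poly x y (?p - 2 * j) (r mod 2))"
    using s by (simp add: double_sum_extend[of ?p k] atMost_atLeast0)
  \<comment> \<open>Reversal to \<open>i = k - j\<close>, so that \<open>2 * i + s\<close> vertices
    lie off the double edges.\<close>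
  also have "\<dots> = (\<Sum>i = 0..k. pairing_number ?p (k - i) * (y\<^sup>2 / 2) ^ (k - i) *
      cap_poly x y (?p - 2 * (k - i)) (r mod 2))"
    by (subst sum.atLeastAtMost_rev) simp
  also have "2 ^ ?p * \<dots> = 2 ^ (k + s) * (\<Sum>i = 0..k. 2 ^ i * of_nat (k choose i) *
       (step_factorial 1 2 (k + s) / step_factorial 1 2 (i + s)) *
       y ^ (2 * k - 2 * i) * multigraph_poly (4 * i + r) x y)"
    unfolding sum_distrib_left
  proof (rule sum.cong[OF refl])
    fix i assume "i \<in> {0..k}"
    then have i: "i \<le> k"
      by simp
    \<comment> \<open>The last factor cancels the denominator of
      \<open>(y\<^sup>2 / 2) ^ (k - i)\<close>; \<open>2 ^ i\<close> stays inside the sum.\<close>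
    have "(2 :: 'a) ^ ?p = 2 ^ (k + s) * 2 ^ i * 2 ^ (k - i)"
    proof -
      have "?p = k + s + i + (k - i)"
        using i by simp
      then show ?thesis
        by (simp only: power_add)
    qed
    moreover have "(y\<^sup>2 / 2) ^ (k - i) = y ^ (2 * k - 2 * i) / 2 ^ (k - i)"
      by (simp add: power_divide diff_mult_distrib2 flip: power_mult)
    moreover have "cap_poly x y (?p - 2 * (k - i)) (r mod 2) = multigraph_poly (4 * i + r) x y"
    proof -
      have "(4 * i + r) div 2 = 2 * i + s" "(4 * i + r) mod 2 = r mod 2"
        unfolding s_def by presburger+
      moreover have "?p - 2 * (k - i) = 2 * i + s"
        using i by simp
      ultimately show ?thesis
        by (simp add: multigraph_poly_eq_cap_poly)
    qed
    ultimately show "2 ^ ?p * (pairing_number ?p (k - i) * (y\<^sup>2 / 2) ^ (k - i) *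
          cap_poly x y (?p - 2 * (k - i)) (r mod 2)) =
        2 ^ (k + s) * (2 ^ i * of_nat (k choose i) *
          (step_factorial 1 2 (k + s) / step_factorial 1 2 (i + s)) *
          y ^ (2 * k - 2 * i) * multigraph_poly (4 * i + r) x y)"
      by (simp add: pairing_number_eq[OF i s])
  qed
  finally show ?thesis
    unfolding s_def .
qed

end
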